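(* Let $\phi\in\mathbf{C}_{[0,1]}$ be strictly convex. Then, for all $n\in\mathbb{N}^*$, $$\widetilde{\delta}_n\ \ge\ \frac{1}{\displaystyle\sup_{y\in\left(0,\frac{\sqrt{12}}{\phi'(0)}\right)}\left(\Psi_\phi^{\sqrt{\ }}\right)'(y)}\ \pi,\qquad\text{and}\qquad \sqrt{\xi_\phi^1}(x)\sim\pi x\ \text{ as } x\to0^+.$$
   Context: $\mathbb{N}^*=\{1,2,\dots\}$. $\mathbf{C}_{[0,1]}$ is the set of $\phi\in C^2([0,1])$ with $\phi'>0$ on $[0,1]$, with either $\phi''>0$ on $[0,1]$ or $\phi''<0$ on $[0,1]$, and with $\phi(0)=0$, $\phi(1)=1$. For $\phi\in\mathbf{C}_{[0,1]}$ let $\omega_\phi^1(x,\theta)=\frac{e_1(\theta)}{(\phi'(x))^2}$ on $[0,1]\times[0,\pi]$, where $e_1(\theta)=\frac{6(1-\cos\theta)}{2+\cos\theta}$. $Rg(\cdot)$ denotes the range (image) of a function and $\mu_2$ the Lebesgue measure on $\mathbb{R}^2$. Set $\Psi_\phi^{\sqrt{\ }}(y)=\mu_2(\{(x,\theta)\in[0,1]\times[0,\pi]:\sqrt{\omega_\phi^1(x,\theta)}\le y\})$. The monotone rearrangement $\xi_\phi^1:[0,1]\to Rg(\omega_\phi^1)$ of $\omega_\phi^1$ is the extension to $[0,1]$ by continuity of $\xi_\phi^1(x)=\inf\{y\in Rg(\omega_\phi^1):\ \mu_2(\{\omega_\phi^1\le y\})>\pi x\}$, $x\in(0,1)$; $\sqrt{\xi_\phi^1}(x)=\sqrt{\xi_\phi^1(x)}$.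 The approximate discrete gap is $$\widetilde{\delta}_n=n\inf_{1\le i\le n-2}\left(\sqrt{\xi_\phi^1\left(\tfrac{i+1}{n}\right)}-\sqrt{\xi_\phi^1\left(\tfrac{i}{n}\right)}\right)$$ (with $\inf\emptyset=+\infty$ when $n\le2$). *)

theory Defs
  imports "HOL-Analysis.Analysis" "HOL-Library.Landau_Symbols"
begin

(* Derivative relative to [0,1]: one-sided at the two endpoints, so nothing is assumed
   about values of f outside the interval. *)
definition D01 :: "(real \<Rightarrow> real) \<Rightarrow> real \<Rightarrow> real" where
  "D01 f x = vector_derivative f (at x within {0..1})"

definition C2_on_01 :: "(real \<Rightarrow> real) \<Rightarrow> bool" where
  "C2_on_01 f \<longleftrightarrow>
     f differentiable_on {0..1} \<and> D01 f differentiable_on {0..1} \<and>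
     continuous_on {0..1} (D01 (D01 f))"

definition C01 :: "(real \<Rightarrow> real) set" where
  "C01 = {\<phi>. C2_on_01 \<phi> \<and>
              (\<forall>x\<in>{0..1}. D01 \<phi> x > 0) \<and>
              ((\<forall>x\<in>{0..1}. D01 (D01 \<phi>) x > 0) \<or> (\<forall>x\<in>{0..1}. D01 (D01 \<phi>) x < 0)) \<and>
              \<phi> 0 = 0 \<and> \<phi> 1 = 1}"

definition strictly_convex_on :: "real set \<Rightarrow> (real \<Rightarrow> real) \<Rightarrow> bool" where
  "strictly_convex_on S f \<longleftrightarrow> convex S \<and>
     (\<forall>x\<in>S. \<forall>y\<in>S. \<forall>t\<in>{0<..<1}. x \<noteq> y \<longrightarrow>
        f ((1 - t) * x + t * y) < (1 - t) * f x + t * f y)"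

definition e1 :: "real \<Rightarrow> real" where
  "e1 \<theta> = 6 * (1 - cos \<theta>) / (2 + cos \<theta>)"

definition symbol_dom :: "(real \<times> real) set" where
  "symbol_dom = {0..1} \<times> {0..pi}"

definition omega1 :: "(real \<Rightarrow> real) \<Rightarrow> real \<times> real \<Rightarrow> real" where
  "omega1 \<phi> = (\<lambda>(x, \<theta>). e1 \<theta> / (D01 \<phi> x)\<^sup>2)"

definition Psi_sqrt :: "(real \<Rightarrow> real) \<Rightarrow> real \<Rightarrow> real" where
  "Psi_sqrt \<phi> y = measure lebesgue {p \<in> symbol_dom. sqrt (omega1 \<phi> p) \<le> y}"

definition xi1_open :: "(real \<Rightarrow> real) \<Rightarrow> real \<Rightarrow> real" where
  "xi1_open \<phi> x = Inf {y \<in> omega1 \<phi> ` symbol_dom.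
     measure lebesgue {p \<in> symbol_dom. omega1 \<phi> p \<le> y} > pi * x}"

(* Meaningful for x in [0,1]; the endpoint values are the continuous extension. *)
definition xi1 :: "(real \<Rightarrow> real) \<Rightarrow> real \<Rightarrow> real" where
  "xi1 \<phi> x = (if x \<in> {0<..<1} then xi1_open \<phi> x
               else Lim (at x within {0<..<1}) (xi1_open \<phi>))"

(* Extended real valued, so that the infimum over the empty index set (n \<le> 2,
   where the truncated difference n - 2 is 0) is +\<infinity>. *)
definition approx_gap :: "(real \<Rightarrow> real) \<Rightarrow> nat \<Rightarrow> ereal" where
  "approx_gap \<phi> n = ereal (real n) *
     (INF i\<in>{1..n - 2}.
        ereal (sqrt (xi1 \<phi> (real (i + 1) / real n)) - sqrt (xi1 \<phi> (real i / real n))))"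

end

theory Submission
  imports Defs "HOL-Real_Asymp.Real_Asymp"
begin

text \<open>
  Write \<open>g\<close> for the derivative of \<open>\<phi>\<close>, which is positive and strictly increasing, \<open>s\<close> for the
  square root of \<^const>\<open>e1\<close>, and \<open>\<Psi>\<close> for \<^term>\<open>Psi_sqrt \<phi>\<close>. Then \<open>\<Psi> y\<close> is the area of the set of
  all \<open>(x, \<theta>)\<close> with \<open>s \<theta> \<le> y * g x\<close>. As \<open>\<Psi>\<close> is continuous, the monotone
  rearrangement inverts it: \<open>\<Psi> (sqrt (xi1 \<phi> x)) = \<pi> x\<close> (lemma \<open>sqrt_xi1_quantile\<close>). Both estimates
  are read off from this identity.

  For the gap (lemma \<open>approx_gap_ge\<close>), apply the mean value theorem to \<open>\<Psi>\<close> between the images of two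
  consecutive nodes, whose \<open>\<Psi>\<close>-values differ by \<open>\<pi> / n\<close>. The main work is that \<open>\<Psi>\<close> is
  differentiable at every \<open>y > 0\<close> (lemma \<open>Psi_sqrt_deriv\<close>). Integrating over \<open>\<theta>\<close> the lengths of the
  slices in \<open>x\<close> gives
  \<open>\<Psi> y = \<integral>\<theta>\<in>{0..\<pi>}. 1 - h (s \<theta> / y)\<close>, where \<open>h\<close> is the inverse of \<open>g\<close> extended by constants.
  The lower bound on \<open>g'\<close> makes \<open>h\<close> Lipschitz, and \<open>h\<close> is differentiable except at two points, so
  one may differentiate under the integral by dominated convergence.

  For the asymptotics, \<open>s \<theta>\<close> is close to \<open>\<theta>\<close> for small \<open>\<theta>\<close>. Hence for small \<open>y\<close> the set is close to
  the region under the graph of \<open>y * g\<close>, whose area is \<open>y * (\<phi> 1 - \<phi> 0) = y\<close>. So \<open>\<Psi> y / y\<close> tends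
  to \<open>1\<close> (lemma \<open>Psi_sqrt_asymp\<close>), and substituting \<open>y = sqrt (xi1 \<phi> x)\<close> finishes the proof.
\<close>

section \<open>Quantiles, differentiation under the integral, slices\<close>

text \<open>A quantile of a continuous function is attained. Closure of the superlevel set gives
  \<open>c \<le> F r\<close>, and the intermediate value theorem the other inequality: a value above \<open>c\<close> at the
  infimum would be preceded by points that still exceed \<open>c\<close>.\<close>

lemma quantile_attained:
  fixes F :: "real \<Rightarrow> real"
  assumes cont: "continuous_on {0..L} F"
    and L: "0 \<le> L" and c: "F 0 < c" "c < F L"
  defines "r \<equiv> Inf {y \<in> {0..L}. c < F y}"
  shows "0 < r" "r < L" "F r = c"
proof -
  define A where "A = {y \<in> {0..L}. c < F y}"
  have LA: "L \<in> A" using L c by (simp add: A_def)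
  have bdd: "bdd_below A" unfolding A_def by (rule bdd_belowI[of _ 0]) auto
  have r: "r = Inf A" by (simp add: r_def A_def)
  have r0: "0 \<le> r" unfolding r using LA by (intro cInf_greatest) (auto simp: A_def)
  have rL: "r \<le> L" unfolding r using LA bdd by (rule cInf_lower)
  have cl: "closure A \<subseteq> {0..L}" by (rule closure_minimal) (auto simp: A_def)
  have "r \<in> closure A" unfolding r using LA bdd by (intro closure_contains_Inf) auto
  then have ge: "c \<le> F r"
    using continuous_ge_on_closure[OF continuous_on_subset[OF cont cl]]
    by (auto simp: A_def intro: less_imp_le)
  have le: "F r \<le> c"
  proof (rule ccontr)
    assume "\<not> F r \<le> c"
    then have "F 0 \<le> (c + F r) / 2" "(c + F r) / 2 \<le> F r" "c < (c + F r) / 2" using c by auto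
    then obtain z where z: "0 \<le> z" "z \<le> r" "F z = (c + F r) / 2"
      using IVT'[of F 0 "(c + F r) / 2" r] r0 rL continuous_on_subset[OF cont, of "{0..r}"] by auto
    then have "z \<in> A" using \<open>c < (c + F r) / 2\<close> rL by (auto simp: A_def)
    then have "r \<le> z" unfolding r using bdd by (rule cInf_lower)
    with z \<open>\<not> F r \<le> c\<close> show False by auto
  qed
  show "F r = c" using ge le by simp
  with c show "0 < r" "r < L" using r0 rL by (auto simp: order_less_le)
qed

text \<open>The difference quotients are bounded by \<open>w\<close>, so dominated convergence applies to them. Asking
  for the derivative only at almost every \<open>t\<close> admits integrands that are Lipschitz but have kinks.\<close>

lemma has_real_derivative_integral_dominated:
  fixes F :: "real \<Rightarrow> 'a \<Rightarrow> real"
  assumes "e > 0"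
    and int: "\<And>y. \<bar>y - y0\<bar> < e \<Longrightarrow> integrable M (F y)"
    and D: "D \<in> borel_measurable M"
    and w: "integrable M w"
    and lip: "\<And>y t. \<bar>y - y0\<bar> < e \<Longrightarrow> t \<in> space M \<Longrightarrow> \<bar>F y t - F y0 t\<bar> \<le> w t * \<bar>y - y0\<bar>"
    and der: "AE t in M. ((\<lambda>y. F y t) has_real_derivative D t) (at y0)"
  shows "((\<lambda>y. \<integral>t. F y t \<partial>M) has_real_derivative (\<integral>t. D t \<partial>M)) (at y0)"
proof -
  let ?I = "\<lambda>y. \<integral>t. F y t \<partial>M"
  \<comment> \<open>Sequences in the ball satisfy the bounds from their first term on.\<close>
  have at: "at y0 within ball y0 e = at y0"
    using \<open>e > 0\<close> by (intro at_within_open) auto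
  have "((\<lambda>y. (?I y - ?I y0) / (y - y0)) \<longlongrightarrow> (\<integral>t. D t \<partial>M)) (at y0 within ball y0 e)"
    unfolding tendsto_at_iff_sequentially o_def
  proof (intro allI impI)
    fix X :: "nat \<Rightarrow> real"
    assume X: "\<forall>i. X i \<in> ball y0 e - {y0}" "X \<longlonglongrightarrow> y0"
    then have Xe: "\<bar>X i - y0\<bar> < e" "X i \<noteq> y0" for i
      by (auto simp: dist_real_def abs_minus_commute)
    have Xat: "filterlim X (at y0) sequentially"
      using X by (auto simp: filterlim_at)
    have "(\<lambda>i. \<integral>t. (F (X i) t - F y0 t) / (X i - y0) \<partial>M) \<longlonglongrightarrow> (\<integral>t. D t \<partial>M)"
    proof (rule integral_dominated_convergence)
      show "D \<in> borel_measurable M" "integrable M w" by fact+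
      show "(\<lambda>t. (F (X i) t - F y0 t) / (X i - y0)) \<in> borel_measurable M" for i
        using int[OF Xe(1)[of i]] int[of y0] \<open>e > 0\<close> by auto
      show "AE t in M. (\<lambda>i. (F (X i) t - F y0 t) / (X i - y0)) \<longlonglongrightarrow> D t"
        using der
      proof eventually_elim
        case (elim t)
        then have "((\<lambda>y. (F y t - F y0 t) / (y - y0)) \<longlongrightarrow> D t) (at y0)"
          by (simp add: has_field_derivative_iff)
        from filterlim_compose[OF this Xat] show ?case .
      qed
      show "AE t in M. norm ((F (X i) t - F y0 t) / (X i - y0)) \<le> w t" for i
        using lip[OF Xe(1)[of i]] Xe(2)[of i] by (auto simp: divide_le_eq)
    qed
    moreover have "(\<integral>t. (F (X i) t - F y0 t) / (X i - y0) \<partial>M) = (?I (X i) - ?I y0) / (X i - y0)" for i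
      using int[OF Xe(1)[of i]] int[of y0] \<open>e > 0\<close> by simp
    ultimately show "(\<lambda>i. (?I (X i) - ?I y0) / (X i - y0)) \<longlonglongrightarrow> (\<integral>t. D t \<partial>M)"
      by (simp only:)
  qed
  then show ?thesis using at by (simp add: has_field_derivative_iff)
qed

text \<open>Cavalieri's principle in both directions. Compactness provides measurability and finite
  measure at once.\<close>

lemma measure_compact_slices:
  fixes C :: "(real \<times> real) set"
  assumes "compact C"
  shows "measure lebesgue C = (\<integral>x. measure lborel {t. (x, t) \<in> C} \<partial>lborel)"
    and "measure lebesgue C = (\<integral>t. measure lborel {x. (x, t) \<in> C} \<partial>lborel)"
proof -
  have C: "C \<in> sets borel" using assms by (simp add: borel_compact)
  then have "measure lebesgue C = (\<integral>p. indicator C p \<partial>lborel)"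
    by (simp add: measure_completion)
  also have "\<dots> = (\<integral>p. indicator C p \<partial>(lborel \<Otimes>\<^sub>M lborel))" by (simp add: lborel_prod)
  finally have eq: "measure lebesgue C = (\<integral>p. indicator C p \<partial>(lborel \<Otimes>\<^sub>M lborel))" .
  have "integrable lborel (indicator C :: _ \<Rightarrow> real)"
    using C emeasure_bounded_finite[OF compact_imp_bounded[OF assms]] by simp
  then have int: "integrable (lborel \<Otimes>\<^sub>M lborel) (\<lambda>(x, t). indicator C (x, t) :: real)"
    by (simp add: lborel_prod)
  have slice1: "(\<integral>t. indicator C (x, t) \<partial>lborel) = measure lborel {t. (x, t) \<in> C}" for x :: real
  proof -
    have "(\<lambda>t. indicator C (x, t) :: real) = indicator {t. (x, t) \<in> C}"
      by (auto simp: indicator_def)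
    then show ?thesis by simp
  qed
  have slice2: "(\<integral>x. indicator C (x, t) \<partial>lborel) = measure lborel {x. (x, t) \<in> C}" for t :: real
  proof -
    have "(\<lambda>x. indicator C (x, t) :: real) = indicator {x. (x, t) \<in> C}"
      by (auto simp: indicator_def)
    then show ?thesis by simp
  qed
  show "measure lebesgue C = (\<integral>x. measure lborel {t. (x, t) \<in> C} \<partial>lborel)"
    using lborel_pair.integral_fst[OF int] eq by (simp add: slice1)
  show "measure lebesgue C = (\<integral>t. measure lborel {x. (x, t) \<in> C} \<partial>lborel)"
    using lborel_pair.integral_snd[OF int] eq by (simp add: slice2)
qed

section \<open>The square root of the symbol\<close>

definition root_symbol :: "real \<Rightarrow> real" where
  "root_symbol \<theta> = sqrt (e1 \<theta>)"

lemma two_plus_cos_pos: "0 < 2 + cos (\<theta>::real)"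
  using cos_ge_minus_one[of \<theta>] by linarith

lemma e1_nonneg: "0 \<le> e1 \<theta>"
  using two_plus_cos_pos[of \<theta>] by (simp add: e1_def)

lemma continuous_on_root_symbol: "continuous_on S root_symbol"
  unfolding root_symbol_def e1_def
  by (intro continuous_intros) (use two_plus_cos_pos in \<open>simp add: less_imp_neq[symmetric]\<close>)

lemma root_symbol_strict_mono:
  assumes "0 \<le> t" "t < u" "u \<le> pi"
  shows "root_symbol t < root_symbol u"
proof -
  have c: "cos u < cos t" using assms by (intro cos_monotone_0_pi) auto
  have "6 * (1 - cos t) * (2 + cos u) < 6 * (1 - cos u) * (2 + cos t)"
    using c by (simp add: algebra_simps)
  then have "e1 t < e1 u" unfolding e1_def
    using two_plus_cos_pos[of t] two_plus_cos_pos[of u] by (simp add: divide_less_eq less_divide_eq mult_ac)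
  then show ?thesis by (simp add: root_symbol_def)
qed

lemma root_symbol_inj: "inj_on root_symbol {0..pi}"
proof (rule inj_onI)
  fix t u assume "t \<in> {0..pi}" "u \<in> {0..pi}" "root_symbol t = root_symbol u"
  then show "t = u"
    using root_symbol_strict_mono[of t u] root_symbol_strict_mono[of u t] by (metis atLeastAtMost_iff linorder_neqE_linordered_idom order_less_irrefl)
qed

lemma root_symbol_0 [simp]: "root_symbol 0 = 0" and root_symbol_pi [simp]: "root_symbol pi = sqrt 12"
  by (simp_all add: root_symbol_def e1_def)

lemma root_symbol_nonneg: "0 \<le> root_symbol t"
  by (simp add: root_symbol_def e1_nonneg)

lemma root_symbol_le: "0 \<le> t \<Longrightarrow> t \<le> pi \<Longrightarrow> root_symbol t \<le> sqrt 12"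
  using root_symbol_strict_mono[of t pi] by (cases "t = pi") auto

text \<open>The normalization of \<^const>\<open>e1\<close>: near \<open>\<theta> = 0\<close> it agrees to leading order with \<open>\<theta>\<^sup>2\<close>, the symbol
  of minus the second derivative.\<close>

lemma root_symbol_asymp: "((\<lambda>\<theta>. root_symbol \<theta> / \<theta>) \<longlongrightarrow> 1) (at_right 0)"
  unfolding root_symbol_def e1_def by real_asymp

section \<open>The derivative of the map and its inverse\<close>

lemma strictly_convex_midpoint:
  assumes "strictly_convex_on {0..1} f"
  shows "f (1/2) < (f 0 + f 1) / 2"
proof -
  have "f ((1 - 1/2) * 0 + 1/2 * 1) < (1 - 1/2) * f 0 + 1/2 * f (1::real)"
    using assms unfolding strictly_convex_on_def
    by (elim conjE ballE[of _ _ 0] ballE[of _ _ 1] ballE[of _ _ "1/2"]) auto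
  then show ?thesis by simp
qed

lemma mean_value_01:
  fixes f f' :: "real \<Rightarrow> real"
  assumes "\<And>x. x \<in> {0..1} \<Longrightarrow> (f has_real_derivative f' x) (at x within {0..1})"
    and "0 \<le> x" "x < y" "y \<le> 1"
  obtains z where "x < z" "z < y" "f y - f x = f' z * (y - x)"
proof -
  have "(f has_derivative (*) (f' z)) (at z within {x..y})" if "x \<le> z" "z \<le> y" for z
    using has_field_derivative_subset[OF assms(1)[of z], of "{x..y}"] that assms(2-4)
    by (auto simp: has_field_derivative_def)
  from mvt_simple[OF \<open>x < y\<close> this] that show thesis by (auto simp: mult.commute)
qed

locale convex_unit_map =
  fixes \<phi> :: "real \<Rightarrow> real"
  assumes C01: "\<phi> \<in> C01" and strictly_convex: "strictly_convex_on {0..1} \<phi>"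
begin

abbreviation "g \<equiv> D01 \<phi>"
abbreviation "g' \<equiv> D01 (D01 \<phi>)"

lemma
  assumes "x \<in> {0..1}"
  shows deriv_phi: "(\<phi> has_real_derivative g x) (at x within {0..1})"
    and deriv_g: "(g has_real_derivative g' x) (at x within {0..1})"
    and g_pos: "0 < g x"
proof -
  have "\<phi> differentiable (at x within {0..1})" "g differentiable (at x within {0..1})" "0 < g x"
    using C01 assms by (auto simp: C01_def C2_on_01_def differentiable_on_def)
  then show "(\<phi> has_real_derivative g x) (at x within {0..1})"
    "(g has_real_derivative g' x) (at x within {0..1})" "0 < g x"
    by (simp_all add: D01_def has_real_derivative_iff_has_vector_derivative vector_derivative_works)
qed

lemma continuous_on_g: "continuous_on {0..1} g"
  by (rule DERIV_continuous_on[OF deriv_g])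

lemma continuous_on_g': "continuous_on {0..1} g'"
  using C01 by (auto simp: C01_def C2_on_01_def)

text \<open>The two sign alternatives in \<^const>\<open>C01\<close> are separated by strict convexity: if the second
  derivative were negative, the mean slope over the right half of the interval would be below the
  one over the left half, against the midpoint inequality.\<close>

lemma g'_pos:
  assumes "x \<in> {0..1}"
  shows "0 < g' x"
proof (rule ccontr)
  assume "\<not> 0 < g' x"
  then have neg: "\<forall>x\<in>{0..1}. g' x < 0" using C01 assms by (auto simp: C01_def)
  obtain z where z: "0 < z" "z < 1/2" "\<phi> (1/2) - \<phi> 0 = g z * (1/2 - 0)"
    by (rule mean_value_01[OF deriv_phi, of 0 "1/2"]) auto
  obtain w where w: "1/2 < w" "w < 1" "\<phi> 1 - \<phi> (1/2) = g w * (1 - 1/2)"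
    by (rule mean_value_01[OF deriv_phi, of "1/2" 1]) auto
  obtain t where t: "z < t" "t < w" "g w - g z = g' t * (w - z)"
    by (rule mean_value_01[OF deriv_g, of z w]) (use z w in auto)
  have "g' t * (w - z) < 0" using neg t z w by (intro mult_neg_pos) auto
  then have "\<phi> 1 - \<phi> (1/2) < \<phi> (1/2) - \<phi> 0" using z w t by simp
  then show False using strictly_convex_midpoint[OF strictly_convex] by simp
qed

definition slope :: real where "slope = Inf (g' ` {0..1})"

lemma slope_pos: "0 < slope" and slope_le: "x \<in> {0..1} \<Longrightarrow> slope \<le> g' x"
proof -
  obtain z where z: "z \<in> {0..1}" "\<forall>x\<in>{0..1}. g' z \<le> g' x"
    using continuous_attains_inf[OF _ _ continuous_on_g'] by auto
  then have "slope = g' z" unfolding slope_def by (intro cInf_eq_minimum) auto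
  then show "0 < slope" "x \<in> {0..1} \<Longrightarrow> slope \<le> g' x" using z g'_pos by auto
qed

lemma g_expansive:
  assumes "0 \<le> x" "x \<le> y" "y \<le> 1"
  shows "slope * (y - x) \<le> g y - g x"
proof (cases "x = y")
  case False
  obtain z where "x < z" "z < y" "g y - g x = g' z * (y - x)"
    by (rule mean_value_01[OF deriv_g, of x y]) (use assms False in auto)
  then show ?thesis using slope_le[of z] assms by (auto intro: mult_right_mono)
qed simp

lemma g_strict_mono: "0 \<le> x \<Longrightarrow> x < y \<Longrightarrow> y \<le> 1 \<Longrightarrow> g x < g y"
  using g_expansive[of x y] mult_pos_pos[OF slope_pos, of "y - x"] by simp

lemma g_less_iff: "x \<in> {0..1} \<Longrightarrow> y \<in> {0..1} \<Longrightarrow> g x < g y \<longleftrightarrow> x < y"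
  using g_strict_mono[of x y] g_strict_mono[of y x] by (cases x y rule: linorder_cases) auto

lemma g_le_iff: "x \<in> {0..1} \<Longrightarrow> y \<in> {0..1} \<Longrightarrow> g x \<le> g y \<longleftrightarrow> x \<le> y"
  using g_less_iff[of y x] by (simp add: not_less[symmetric])

lemma g_inj: "inj_on g {0..1}"
proof (rule inj_onI)
  fix x y assume "x \<in> {0..1}" "y \<in> {0..1}" "g x = g y"
  then show "x = y" using g_le_iff[of x y] g_le_iff[of y x] by simp
qed

definition truncate :: "real \<Rightarrow> real" where "truncate v = max (g 0) (min (g 1) v)"

text \<open>The inverse of \<^term>\<open>g\<close>, extended by the constants \<open>0\<close> and \<open>1\<close> to the whole line. For every
  real \<open>v\<close> it is the length of \<open>{x \<in> {0..1}. g x < v}\<close>, and the extension keeps it Lipschitz.\<close>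

definition level :: "real \<Rightarrow> real" where
  "level v = the_inv_into {0..1} g (truncate v)"

lemma level_mem: "level v \<in> {0..1}" and g_level: "g (level v) = truncate v"
proof -
  have "g 0 \<le> truncate v" "truncate v \<le> g 1" using g_le_iff[of 0 1] by (auto simp: truncate_def)
  then have "truncate v \<in> g ` {0..1}"
    using IVT'[of g 0 "truncate v" 1] continuous_on_g by force
  then show "level v \<in> {0..1}" "g (level v) = truncate v"
    unfolding level_def using g_inj by (auto intro: the_inv_into_into f_the_inv_into_f simp del: atLeastAtMost_iff)
qed

lemma level_le_iff:
  assumes "x \<in> {0..1}" "v \<le> g 1"
  shows "level v \<le> x \<longleftrightarrow> v \<le> g x"
proof -
  have "g 0 \<le> g x" using g_le_iff[of 0 x] assms by simp
  then show ?thesis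
    using g_le_iff[OF level_mem assms(1), of v] assms by (auto simp: g_level truncate_def)
qed

lemma level_low: "v \<le> g 0 \<Longrightarrow> level v = 0" and level_high: "g 1 \<le> v \<Longrightarrow> level v = 1"
proof -
  have g01: "g 0 \<le> g 1" using g_le_iff[of 0 1] by simp
  show "level v = 0" if "v \<le> g 0"
    using that g01 g_level[of v] inj_onD[OF g_inj _ level_mem[of v], of 0] by (simp add: truncate_def)
  show "level v = 1" if "g 1 \<le> v"
    using that g01 g_level[of v] inj_onD[OF g_inj _ level_mem[of v], of 1] by (simp add: truncate_def)
qed

lemma level_lipschitz: "\<bar>level v - level w\<bar> \<le> \<bar>v - w\<bar> / slope"
proof -
  have "slope * \<bar>level v - level w\<bar> \<le> \<bar>g (level v) - g (level w)\<bar>"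
    using g_expansive[of "level v" "level w"] g_expansive[of "level w" "level v"]
      level_mem[of v] level_mem[of w] by (cases "level v \<le> level w") auto
  also have "\<dots> \<le> \<bar>v - w\<bar>" unfolding g_level truncate_def by linarith
  finally show ?thesis using slope_pos by (simp add: field_simps)
qed

lemma continuous_on_level: "continuous_on S level"
proof (rule lipschitz_on_continuous_on)
  show "(1 / slope)-lipschitz_on S level"
    using level_lipschitz slope_pos by (intro lipschitz_onI) (auto simp: dist_real_def)
qed

text \<open>The derivative of \<^term>\<open>level\<close> away from its two kinks \<open>g 0\<close> and \<open>g 1\<close>; at the kinks, which
  the integrals below do not see, the value \<open>0\<close> is a convention.\<close>

definition dlevel :: "real \<Rightarrow> real" where
  "dlevel v = (if g 0 < v \<and> v < g 1 then 1 / g' (level v) else 0)"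

lemma dlevel_measurable: "dlevel \<in> borel_measurable borel"
proof -
  have "continuous_on UNIV (\<lambda>v. g' (level v))"
    using level_mem by (intro continuous_on_compose2[OF continuous_on_g' continuous_on_level]) auto
  then have "(\<lambda>v. g' (level v)) \<in> borel_measurable borel"
    by (rule borel_measurable_continuous_onI)
  then show ?thesis unfolding dlevel_def[abs_def] by measurable
qed

lemma level_deriv:
  assumes "v \<noteq> g 0" "v \<noteq> g 1"
  shows "(level has_real_derivative dlevel v) (at v)"
proof -
  have g01: "g 0 < g 1" using g_less_iff[of 0 1] by simp
  consider "v < g 0" | "g 1 < v" | "g 0 < v" "v < g 1" using assms by linarith
  then show ?thesis
  proof cases
    case 1
    then have "((\<lambda>_. 0) has_real_derivative 0) (at v) \<longleftrightarrow> (level has_real_derivative dlevel v) (at v)"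
      using level_low by (intro has_field_derivative_cong_ev eventually_mono[OF eventually_nhds_in_open[of "{..<g 0}"]])
        (auto simp: dlevel_def)
    then show ?thesis by simp
  next
    case 2
    have "(level has_real_derivative 0) (at v)"
    proof (rule has_field_derivative_transform_within_open[where S = "{g 1<..}" and f = "\<lambda>_. 1"])
    qed (use 2 level_high in auto)
    then show ?thesis using 2 g01 by (simp add: dlevel_def)
  next
    case 3
    have "level v \<noteq> 0" "level v \<noteq> 1" using 3 g_level[of v] g01 by (auto simp: truncate_def)
    then have int: "0 < level v" "level v < 1" using level_mem[of v] by auto
    have "(level has_real_derivative inverse (g' (level v))) (at v)"
    proof (rule DERIV_inverse_function[where f = g and a = "g 0" and b = "g 1"])
      show "(g has_real_derivative g' (level v)) (at (level v))"
        using deriv_g[of "level v"] int by (simp add: at_within_Icc_at)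
      show "g' (level v) \<noteq> 0" using g'_pos[OF level_mem[of v]] by simp
      show "g (level y) = y" if "g 0 < y" "y < g 1" for y
        using that by (simp add: g_level truncate_def)
      show "isCont level v" using continuous_on_level[of UNIV] by (simp add: continuous_on_eq_continuous_at)
    qed (use 3 in auto)
    then show ?thesis using 3 by (simp add: dlevel_def inverse_eq_divide)
  qed
qed

section \<open>The distribution function and its derivative\<close>

definition sublevel :: "real \<Rightarrow> (real \<times> real) set" where
  "sublevel y = {(x, \<theta>). x \<in> {0..1} \<and> \<theta> \<in> {0..pi} \<and> root_symbol \<theta> \<le> y * g x}"

lemma sqrt_omega1: "x \<in> {0..1} \<Longrightarrow> sqrt (omega1 \<phi> (x, \<theta>)) = root_symbol \<theta> / g x"
  using g_pos[of x] by (simp add: omega1_def root_symbol_def real_sqrt_divide)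

lemma Psi_sqrt_eq: "Psi_sqrt \<phi> y = measure lebesgue (sublevel y)"
proof -
  have "{p \<in> symbol_dom. sqrt (omega1 \<phi> p) \<le> y} = sublevel y"
    using sqrt_omega1 g_pos by (auto simp: symbol_dom_def sublevel_def divide_le_eq)
  then show ?thesis by (simp add: Psi_sqrt_def)
qed

lemma compact_sublevel: "compact (sublevel y)"
proof -
  have "closed {p \<in> {0..1} \<times> {0..pi}. root_symbol (snd p) \<le> y * g (fst p)}"
  proof (rule continuous_on_closed_Collect_le)
    show "continuous_on ({0..1} \<times> {0..pi}) (\<lambda>p. root_symbol (snd p))"
      by (rule continuous_on_compose2[OF continuous_on_root_symbol[of UNIV]]) (auto intro: continuous_intros)
    have "continuous_on ({0..1} \<times> {0..pi}) (\<lambda>p. g (fst p))"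
      by (rule continuous_on_compose2[OF continuous_on_g]) (auto intro: continuous_intros)
    then show "continuous_on ({0..1} \<times> {0..pi}) (\<lambda>p. y * g (fst p))"
      by (intro continuous_intros)
    show "closed ({0..1::real} \<times> {0..pi})" by (intro closed_Times) auto
  qed
  moreover have "{p \<in> {0..1} \<times> {0..pi}. root_symbol (snd p) \<le> y * g (fst p)} = sublevel y"
    by (auto simp: sublevel_def)
  moreover have "bounded ({0..1::real} \<times> {0..pi})" by (intro bounded_Times) auto
  ultimately show ?thesis
    by (auto simp: compact_eq_bounded_closed sublevel_def intro: bounded_subset)
qed

text \<open>The area is cut along \<open>\<theta>\<close> rather than along \<open>x\<close>. The slices in \<open>x\<close> have length
  \<open>1 - level (root_symbol \<theta> / y)\<close>, a Lipschitz function of \<open>y\<close>. Slices in \<open>\<theta>\<close> would bring in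
  the inverse of \<^const>\<open>root_symbol\<close>, whose derivative blows up at \<open>sqrt 12\<close>.\<close>

lemma Psi_sqrt_eq_integral:
  assumes "0 < y"
  shows "Psi_sqrt \<phi> y = (\<integral>\<theta>. indicator {0..pi} \<theta> * (1 - level (root_symbol \<theta> / y)) \<partial>lborel)"
proof -
  have "measure lborel {x. (x, \<theta>) \<in> sublevel y} = indicator {0..pi} \<theta> * (1 - level (root_symbol \<theta> / y))" for \<theta>
  proof (cases "\<theta> \<in> {0..pi}")
    case True
    let ?v = "root_symbol \<theta> / y"
    have sl: "{x. (x, \<theta>) \<in> sublevel y} = {x \<in> {0..1}. ?v \<le> g x}"
      using True assms by (auto simp: sublevel_def divide_le_eq mult.commute)
    show ?thesis
    proof (cases "?v \<le> g 1")
      case le: True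
      then have "{x \<in> {0..1}. ?v \<le> g x} = {level ?v..1}"
      proof (intro set_eqI)
        show "x \<in> {x \<in> {0..1}. ?v \<le> g x} \<longleftrightarrow> x \<in> {level ?v..1}" for x
          using level_le_iff[OF _ le, of x] level_mem[of ?v] by (cases "x \<in> {0..1}") auto
      qed
      then show ?thesis using True sl level_mem[of ?v] by simp
    next
      case False
      have "{x \<in> {0..1}. ?v \<le> g x} = {}"
        using False g_le_iff[of _ 1] by fastforce
      moreover have "level ?v = 1" using False by (intro level_high) simp
      ultimately show ?thesis by (simp only: sl measure_empty) simp
    qed
  next
    case False
    then have "{x. (x, \<theta>) \<in> sublevel y} = {}" by (auto simp: sublevel_def)
    with False show ?thesis by simp
  qed
  then show ?thesis
    unfolding Psi_sqrt_eq measure_compact_slices(2)[OF compact_sublevel] by simp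
qed

text \<open>Under the integral sign, the integrand is differentiable at \<open>y0\<close> unless \<open>root_symbol \<theta> / y0\<close> is
  one of the two kinks of \<^term>\<open>level\<close>. As \<^const>\<open>root_symbol\<close> is injective, this excludes at
  most two values of \<open>\<theta>\<close>. In particular the point \<open>y0 = sqrt 12 / g 1\<close>, from which on the
  sublevel sets reach the side \<open>\<theta> = \<pi>\<close>, is no exception.\<close>

lemma Psi_sqrt_deriv:
  assumes y0: "0 < y0"
  shows "\<exists>d. (Psi_sqrt \<phi> has_real_derivative d) (at y0)"
proof -
  define D where "D \<theta> = indicator {0..pi} \<theta> * (dlevel (root_symbol \<theta> / y0) * (root_symbol \<theta> / y0\<^sup>2))" for \<theta>
  define F where "F y \<theta> = indicator {0..pi} \<theta> * (1 - level (root_symbol \<theta> / y))" for y \<theta>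
  \<comment> \<open>Lipschitz constant in \<open>y\<close> of the integrand, for \<open>y\<close> above \<open>y0 / 2\<close>\<close>
  define K where "K = 2 * sqrt 12 / (slope * y0\<^sup>2)"
  have pos: "0 < y" "y0 / 2 < y" if "\<bar>y - y0\<bar> < y0 / 2" for y using that y0 by (auto simp: abs_if split: if_splits)
  have "((\<lambda>y. \<integral>\<theta>. F y \<theta> \<partial>lborel) has_real_derivative (\<integral>\<theta>. D \<theta> \<partial>lborel)) (at y0)"
  proof (rule has_real_derivative_integral_dominated[where e = "y0 / 2" and w = "\<lambda>\<theta>. indicator {0..pi} \<theta> *\<^sub>R K"])
    show "0 < y0 / 2" using y0 by simp
    show "integrable lborel (\<lambda>\<theta>. indicator {0..pi} \<theta> *\<^sub>R K)"
      by (intro borel_integrable_compact) auto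
    show "integrable lborel (F y)" if "\<bar>y - y0\<bar> < y0 / 2" for y
    proof -
      have "continuous_on {0..pi} (\<lambda>\<theta>. 1 - level (root_symbol \<theta> / y))"
        using pos[OF that]
        by (intro continuous_intros continuous_on_compose2[OF continuous_on_level[of UNIV]] continuous_on_root_symbol) auto
      from borel_integrable_compact[OF _ this] show ?thesis by (simp add: F_def[abs_def])
    qed
    have [measurable]: "root_symbol \<in> borel_measurable borel"
      by (intro borel_measurable_continuous_onI continuous_on_root_symbol)
    note dlevel_measurable[measurable]
    show "D \<in> borel_measurable lborel" unfolding D_def[abs_def] by measurable
    show "\<bar>F y \<theta> - F y0 \<theta>\<bar> \<le> indicator {0..pi} \<theta> *\<^sub>R K * \<bar>y - y0\<bar>"
      if "\<bar>y - y0\<bar> < y0 / 2" for y \<theta>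
    proof (cases "\<theta> \<in> {0..pi}")
      case True
      let ?s = "root_symbol \<theta>"
      have yy: "0 < y" "y0 / 2 < y" using pos[OF that] .
      have "\<bar>F y \<theta> - F y0 \<theta>\<bar> = \<bar>level (?s / y) - level (?s / y0)\<bar>" using True by (simp add: F_def)
      also have "\<dots> \<le> \<bar>?s / y - ?s / y0\<bar> / slope" by (rule level_lipschitz)
      also have "?s / y - ?s / y0 = ?s / (y * y0) * (y0 - y)" using y0 yy by (simp add: field_simps)
      also have "\<bar>?s / (y * y0) * (y0 - y)\<bar> = ?s / (y * y0) * \<bar>y - y0\<bar>"
        using root_symbol_nonneg[of \<theta>] y0 yy by (simp add: abs_mult abs_minus_commute)
      also have "?s / (y * y0) * \<bar>y - y0\<bar> / slope \<le> sqrt 12 / (y0 / 2 * y0) * \<bar>y - y0\<bar> / slope"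
        using root_symbol_le[of \<theta>] True root_symbol_nonneg[of \<theta>] y0 yy slope_pos
        by (intro divide_right_mono mult_right_mono frac_le) auto
      also have "\<dots> = K * \<bar>y - y0\<bar>" using y0 slope_pos by (simp add: K_def field_simps power2_eq_square)
      finally show ?thesis using True by simp
    qed (simp add: F_def)
    show "AE \<theta> in lborel. ((\<lambda>y. F y \<theta>) has_real_derivative D \<theta>) (at y0)"
    proof (rule AE_I')
      let ?N = "{\<theta> \<in> {0..pi}. root_symbol \<theta> \<in> {g 0 * y0, g 1 * y0}}"
      have "finite (root_symbol -` {g 0 * y0, g 1 * y0} \<inter> {0..pi})"
        by (intro finite_vimage_IntI root_symbol_inj) auto
      then have "finite ?N" by (rule finite_subset[rotated]) auto
      then show "?N \<in> null_sets lborel" by (intro finite_imp_null_set_lborel)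
      show "{\<theta> \<in> space lborel. \<not> ((\<lambda>y. F y \<theta>) has_real_derivative D \<theta>) (at y0)} \<subseteq> ?N"
      proof (rule subsetI, rule ccontr)
        fix \<theta> assume \<theta>: "\<theta> \<in> {\<theta> \<in> space lborel. \<not> ((\<lambda>y. F y \<theta>) has_real_derivative D \<theta>) (at y0)}" "\<theta> \<notin> ?N"
        show False
        proof (cases "\<theta> \<in> {0..pi}")
          case True
          let ?s = "root_symbol \<theta>"
          have "?s / y0 \<noteq> g 0" "?s / y0 \<noteq> g 1" using True \<theta> y0 by (auto simp: field_simps)
          note lev = level_deriv[OF this]
          have "((\<lambda>y. ?s / y) has_real_derivative - ?s / y0\<^sup>2) (at y0)"
            using y0 by (auto intro!: derivative_eq_intros simp: power2_eq_square)
          from DERIV_chain2[OF lev this]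
          have "((\<lambda>y. 1 - level (?s / y)) has_real_derivative 0 - dlevel (?s / y0) * (- ?s / y0\<^sup>2)) (at y0)"
            by (intro DERIV_diff DERIV_const)
          then show False using \<theta> True by (simp add: F_def D_def)
        next
          case False
          then show False using \<theta> by (simp add: F_def D_def)
        qed
      qed
    qed
  qed
  moreover have "(\<integral>\<theta>. F y \<theta> \<partial>lborel) = Psi_sqrt \<phi> y" if "y \<in> {0<..}" for y
    using Psi_sqrt_eq_integral[of y] that by (simp add: F_def)
  ultimately have "(Psi_sqrt \<phi> has_real_derivative (\<integral>\<theta>. D \<theta> \<partial>lborel)) (at y0)"
    using has_field_derivative_transform_within_open[of _ _ y0 "{0<..}"] y0 by (auto simp del: greaterThan_iff) 
  then show ?thesis ..
qed

section \<open>The distribution function near the origin\<close>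

text \<open>For small \<open>y\<close> the set \<^term>\<open>sublevel y\<close> is nearly \<^term>\<open>under_graph y\<close>, because
  \<^const>\<open>root_symbol\<close> is nearly the identity near \<open>0\<close>. The area of the latter is exact: the integral
  of \<open>g = \<phi>'\<close> is \<open>\<phi> 1 - \<phi> 0 = 1\<close>.\<close>

definition under_graph :: "real \<Rightarrow> (real \<times> real) set" where
  "under_graph k = {(x, \<theta>). x \<in> {0..1} \<and> 0 \<le> \<theta> \<and> \<theta> \<le> k * g x}"

lemma compact_under_graph:
  assumes "0 \<le> k"
  shows "compact (under_graph k)"
proof -
  let ?B = "{0..1::real} \<times> {0..k * g 1}"
  have "closed {p \<in> ?B. snd p \<le> k * g (fst p)}"
  proof (rule continuous_on_closed_Collect_le)
    have "continuous_on ?B (\<lambda>p. g (fst p))"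
      by (rule continuous_on_compose2[OF continuous_on_g]) (auto intro: continuous_intros)
    then show "continuous_on ?B (\<lambda>p. k * g (fst p))"
      by (intro continuous_intros)
    show "closed ?B" by (intro closed_Times) auto
  qed (intro continuous_intros)
  moreover have "{p \<in> ?B. snd p \<le> k * g (fst p)} = under_graph k"
    using mult_left_mono[OF _ assms] g_le_iff[of _ 1]
    by (fastforce simp: under_graph_def)
  moreover have "bounded ?B" by (intro bounded_Times) auto
  ultimately show ?thesis
    by (metis (no_types, lifting) bounded_subset compact_eq_bounded_closed mem_Collect_eq subsetI)
qed

lemma measure_under_graph:
  assumes "0 \<le> k"
  shows "measure lebesgue (under_graph k) = k"
proof -
  have "measure lborel {\<theta>. (x, \<theta>) \<in> under_graph k} = indicator {0..1} x *\<^sub>R (k * g x)" for x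
  proof (cases "x \<in> {0..1}")
    case True
    then have "{\<theta>. (x, \<theta>) \<in> under_graph k} = {0..k * g x}" by (auto simp: under_graph_def)
    then show ?thesis using True g_pos[of x] assms by simp
  next
    case False
    then have "{\<theta>. (x, \<theta>) \<in> under_graph k} = {}" by (auto simp: under_graph_def)
    with False show ?thesis by simp
  qed
  then have "measure lebesgue (under_graph k) = (\<integral>x. indicator {0..1} x *\<^sub>R (k * g x) \<partial>lborel)"
    by (simp add: measure_compact_slices(1)[OF compact_under_graph[OF assms]])
  also have "\<dots> = k * \<phi> 1 - k * \<phi> 0"
  proof (rule integral_FTC_Icc)
    show "((\<lambda>x. k * \<phi> x) has_vector_derivative k * g x) (at x within {0..1})"
      if "0 \<le> x" "x \<le> 1" for x
      using DERIV_cmult[OF deriv_phi[of x], of k] that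
      by (simp add: has_real_derivative_iff_has_vector_derivative)
    show "continuous_on {0..1} (\<lambda>x. k * g x)" by (intro continuous_intros continuous_on_g)
  qed simp
  finally show ?thesis using C01 by (simp add: C01_def)
qed

lemma Psi_sqrt_mono:
  assumes "y \<le> z"
  shows "Psi_sqrt \<phi> y \<le> Psi_sqrt \<phi> z"
proof -
  have "sublevel y \<subseteq> sublevel z"
  proof (clarsimp simp: sublevel_def)
    fix x \<theta> :: real assume "0 \<le> x" "x \<le> 1" "root_symbol \<theta> \<le> y * g x"
    then show "root_symbol \<theta> \<le> z * g x"
      using order_trans[OF _ mult_right_mono[OF assms, of "g x"]] g_pos[of x] by simp
  qed
  then show ?thesis unfolding Psi_sqrt_eq
    by (intro measure_mono_fmeasurable) (auto intro: lmeasurable_compact compact_sublevel fmeasurableD)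
qed

text \<open>The next two lemmas squeeze \<^term>\<open>sublevel y\<close> between \<^term>\<open>under_graph (q * y)\<close> for \<open>q\<close> just
  below and just above \<open>1\<close>.\<close>

lemma Psi_sqrt_lower:
  assumes q: "0 < q" "q < 1"
  shows "eventually (\<lambda>y. q * y \<le> Psi_sqrt \<phi> y) (at_right 0)"
proof -
  have g1: "0 < g 1" using g_pos[of 1] by simp
  have "eventually (\<lambda>\<theta>. root_symbol \<theta> / \<theta> < 1 / q) (at_right 0)"
    using q by (intro order_tendstoD(2)[OF root_symbol_asymp]) simp
  then obtain \<delta> where \<delta>: "0 < \<delta>" "\<And>\<theta>. 0 < \<theta> \<Longrightarrow> \<theta> < \<delta> \<Longrightarrow> root_symbol \<theta> / \<theta> < 1 / q"
    by (auto simp: eventually_at_right_field)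
  have "q * y \<le> Psi_sqrt \<phi> y" if y: "0 < y" "y < min \<delta> pi / (q * g 1)" for y
  proof -
    have sub: "under_graph (q * y) \<subseteq> sublevel y"
    proof (clarsimp simp: under_graph_def sublevel_def)
      fix x \<theta> :: real assume x: "0 \<le> x" "x \<le> 1" and \<theta>: "0 \<le> \<theta>" "\<theta> \<le> q * y * g x"
      have "q * y * g x \<le> q * y * g 1" using x q y g_le_iff[of x 1] by (intro mult_left_mono) auto
      also have "\<dots> < min \<delta> pi" using y q g1 by (simp add: field_simps)
      finally have small: "\<theta> < \<delta>" "\<theta> < pi" using \<theta> by auto
      have "root_symbol \<theta> \<le> \<theta> / q" using \<delta>(2)[of \<theta>] small \<theta> q by (cases "\<theta> = 0") (auto simp: field_simps)
      also have "\<dots> \<le> y * g x" using \<theta> q by (simp add: field_simps)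
      finally show "\<theta> \<le> pi \<and> root_symbol \<theta> \<le> y * g x" using small by simp
    qed
    have "0 \<le> q * y" using q y by simp
    then have "q * y = measure lebesgue (under_graph (q * y))" by (simp add: measure_under_graph)
    also have "\<dots> \<le> Psi_sqrt \<phi> y" unfolding Psi_sqrt_eq
      using sub \<open>0 \<le> q * y\<close>
      by (intro measure_mono_fmeasurable) (auto intro: lmeasurable_compact compact_sublevel compact_under_graph fmeasurableD)
    finally show ?thesis .
  qed
  moreover have "0 < min \<delta> pi / (q * g 1)" using \<delta> q g1 by simp
  ultimately show ?thesis unfolding eventually_at_right_field by blast
qed

lemma Psi_sqrt_upper:
  assumes q: "1 < q"
  shows "eventually (\<lambda>y. Psi_sqrt \<phi> y \<le> q * y) (at_right 0)"
proof -
  have g1: "0 < g 1" using g_pos[of 1] by simp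
  have "eventually (\<lambda>\<theta>. 1 / q < root_symbol \<theta> / \<theta>) (at_right 0)"
    using q by (intro order_tendstoD(1)[OF root_symbol_asymp]) simp
  then obtain \<delta> where \<delta>: "0 < \<delta>" "\<And>\<theta>. 0 < \<theta> \<Longrightarrow> \<theta> < \<delta> \<Longrightarrow> 1 / q < root_symbol \<theta> / \<theta>"
    by (auto simp: eventually_at_right_field)
  \<comment> \<open>Halved so that \<open>\<theta> < \<eta>\<close> can be read off from the values of \<^const>\<open>root_symbol\<close>, which
    requires \<open>\<eta>\<close> itself to lie inside \<open>{0<..<pi}\<close>.\<close>
  define \<eta> where "\<eta> = min \<delta> pi / 2"
  have \<eta>: "0 < \<eta>" "\<eta> < \<delta>" "\<eta> < pi" using \<delta> by (auto simp: \<eta>_def min_def)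
  have s: "0 < root_symbol \<eta>" using root_symbol_strict_mono[of 0 \<eta>] \<eta> by simp
  have "Psi_sqrt \<phi> y \<le> q * y" if y: "0 < y" "y < root_symbol \<eta> / g 1" for y
  proof -
    have sub: "sublevel y \<subseteq> under_graph (q * y)"
    proof (clarsimp simp: under_graph_def sublevel_def)
      fix x \<theta> :: real
      assume x: "0 \<le> x" "x \<le> 1" and \<theta>: "0 \<le> \<theta>" "\<theta> \<le> pi" "root_symbol \<theta> \<le> y * g x"
      have "y * g x \<le> y * g 1" using x y g_le_iff[of x 1] by (intro mult_left_mono) auto
      also have "\<dots> < root_symbol \<eta>" using y g1 by (simp add: field_simps)
      finally have "root_symbol \<theta> < root_symbol \<eta>" using \<theta> by simp
      then have "\<theta> < \<eta>" using root_symbol_strict_mono[of \<eta> \<theta>] \<eta> \<theta> by (cases \<theta> \<eta> rule: linorder_cases) auto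
      then have "\<theta> \<le> q * root_symbol \<theta>"
        using \<delta>(2)[of \<theta>] \<eta> \<theta> q by (cases "\<theta> = 0") (auto simp: field_simps)
      also have "\<dots> \<le> q * (y * g x)" using \<theta> q by (intro mult_left_mono) auto
      finally show "\<theta> \<le> q * y * g x" by (simp add: mult.assoc)
    qed
    have "0 \<le> q * y" using q y by simp
    have "Psi_sqrt \<phi> y \<le> measure lebesgue (under_graph (q * y))" unfolding Psi_sqrt_eq
      using sub \<open>0 \<le> q * y\<close>
      by (intro measure_mono_fmeasurable) (auto intro: lmeasurable_compact compact_sublevel compact_under_graph fmeasurableD)
    also have "\<dots> = q * y" using \<open>0 \<le> q * y\<close> by (simp add: measure_under_graph)
    finally show ?thesis .
  qed
  moreover have "0 < root_symbol \<eta> / g 1" using s g1 by simp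
  ultimately show ?thesis unfolding eventually_at_right_field by blast
qed

lemma Psi_sqrt_asymp: "((\<lambda>y. Psi_sqrt \<phi> y / y) \<longlongrightarrow> 1) (at_right 0)"
proof (rule order_tendstoI)
  fix a :: real assume "a < 1"
  then obtain q where q: "max a 0 < q" "q < 1" using dense[of "max a 0" 1] by auto
  have "eventually (\<lambda>y. q * y \<le> Psi_sqrt \<phi> y) (at_right 0)" using q by (intro Psi_sqrt_lower) auto
  moreover have "eventually (\<lambda>y. 0 < y) (at_right (0::real))" by (rule eventually_at_right_less)
  ultimately show "eventually (\<lambda>y. a < Psi_sqrt \<phi> y / y) (at_right 0)"
  proof eventually_elim
    case (elim y)
    then have "q \<le> Psi_sqrt \<phi> y / y" by (simp add: field_simps)
    then show ?case using q by simp
  qed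
next
  fix a :: real assume "1 < a"
  then obtain q where q: "1 < q" "q < a" using dense[of 1 a] by auto
  have "eventually (\<lambda>y. Psi_sqrt \<phi> y \<le> q * y) (at_right 0)" using q by (intro Psi_sqrt_upper) auto
  moreover have "eventually (\<lambda>y. 0 < y) (at_right (0::real))" by (rule eventually_at_right_less)
  ultimately show "eventually (\<lambda>y. Psi_sqrt \<phi> y / y < a) (at_right 0)"
  proof eventually_elim
    case (elim y)
    then have "Psi_sqrt \<phi> y / y \<le> q" by (simp add: field_simps)
    then show ?case using q by simp
  qed
qed

lemma Psi_sqrt_tendsto_0: "(Psi_sqrt \<phi> \<longlongrightarrow> 0) (at_right 0)"
proof -
  have "((\<lambda>y. Psi_sqrt \<phi> y / y * y) \<longlongrightarrow> 1 * 0) (at_right 0)"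
    by (intro tendsto_mult Psi_sqrt_asymp tendsto_ident_at)
  then have "((\<lambda>y. Psi_sqrt \<phi> y / y * y) \<longlongrightarrow> 0) (at_right 0)" by simp
  then show ?thesis
    by (rule Lim_transform_eventually) (auto simp: eventually_at_right_field intro: exI[of _ 1])
qed

lemma Psi_sqrt_0: "Psi_sqrt \<phi> 0 = 0"
proof -
  have "Psi_sqrt \<phi> 0 \<le> 0"
    by (rule tendsto_lowerbound[OF Psi_sqrt_tendsto_0])
      (auto simp: eventually_at_right_field intro!: Psi_sqrt_mono exI[of _ 1])
  moreover have "0 \<le> Psi_sqrt \<phi> 0" unfolding Psi_sqrt_def by (rule measure_nonneg)
  ultimately show ?thesis by simp
qed

lemma Psi_sqrt_pos:
  assumes "0 < y"
  shows "0 < Psi_sqrt \<phi> y"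
proof -
  obtain b where b: "0 < b" "\<And>z. 0 < z \<Longrightarrow> z < b \<Longrightarrow> 1/2 * z \<le> Psi_sqrt \<phi> z"
    using Psi_sqrt_lower[of "1/2"] by (auto simp: eventually_at_right_field)
  define z where "z = min y (b / 2)"
  have "0 < 1/2 * z" using assms b by (simp add: z_def)
  also have "\<dots> \<le> Psi_sqrt \<phi> z" using assms b by (intro b(2)) (auto simp: z_def)
  also have "\<dots> \<le> Psi_sqrt \<phi> y" by (rule Psi_sqrt_mono) (simp add: z_def)
  finally show ?thesis .
qed

lemma continuous_on_Psi_sqrt: "continuous_on {0..} (Psi_sqrt \<phi>)"
  unfolding continuous_on_def
proof
  fix y :: real assume "y \<in> {0..}"
  then consider "y = 0" | "0 < y" by fastforce
  then show "(Psi_sqrt \<phi> \<longlongrightarrow> Psi_sqrt \<phi> y) (at y within {0..})"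
  proof cases
    case 1
    have "at (0::real) within {0..} = at_right 0" by (rule at_within_Ici_at_right)
    with 1 show ?thesis using Psi_sqrt_tendsto_0 by (simp add: Psi_sqrt_0)
  next
    case 2
    then obtain d where "(Psi_sqrt \<phi> has_real_derivative d) (at y)" using Psi_sqrt_deriv by blast
    then have "isCont (Psi_sqrt \<phi>) y" by (rule DERIV_isCont)
    then show ?thesis by (simp add: isCont_def tendsto_within_subset[OF _ subset_UNIV])
  qed
qed

section \<open>The rearrangement and its gaps\<close>

text \<open>The maximum of \<open>sqrt (omega1 \<phi> p)\<close>, attained at \<open>x = 0\<close>, \<open>\<theta> = \<pi>\<close> because \<^term>\<open>g\<close> increases.\<close>

definition ymax :: real where "ymax = sqrt 12 / g 0"

lemma ymax_pos: "0 < ymax"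
  using g_pos[of 0] by (simp add: ymax_def)

lemma Psi_sqrt_ymax: "Psi_sqrt \<phi> ymax = pi"
proof -
  have g0: "0 < g 0" using g_pos[of 0] by simp
  have "sublevel ymax = {0..1} \<times> {0..pi}"
  proof -
    have "root_symbol \<theta> \<le> ymax * g x" if "x \<in> {0..1}" "\<theta> \<in> {0..pi}" for x \<theta>
    proof -
      have "root_symbol \<theta> \<le> ymax * g 0" using root_symbol_le[of \<theta>] that g0 by (simp add: ymax_def)
      also have "\<dots> \<le> ymax * g x" using g_le_iff[of 0 x] that ymax_pos by (intro mult_left_mono) auto
      finally show ?thesis .
    qed
    then show ?thesis by (auto simp: sublevel_def)
  qed
  also have "\<dots> = cbox (0, 0) (1, pi)" by (simp add: cbox_Pair_eq)
  finally show ?thesis by (simp add: Psi_sqrt_eq content_Pair)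
qed

lemma omega1_eq: "x \<in> {0..1} \<Longrightarrow> omega1 \<phi> (x, \<theta>) = (root_symbol \<theta> / g x)\<^sup>2"
  using e1_nonneg[of \<theta>] by (simp add: omega1_def root_symbol_def power_divide)

lemma range_omega1: "omega1 \<phi> ` symbol_dom = {0..ymax\<^sup>2}"
proof (intro equalityI subsetI)
  fix z assume "z \<in> omega1 \<phi> ` symbol_dom"
  then obtain x \<theta> where p: "x \<in> {0..1}" "\<theta> \<in> {0..pi}" "z = (root_symbol \<theta> / g x)\<^sup>2"
    by (auto simp: symbol_dom_def omega1_eq)
  have "root_symbol \<theta> / g x \<le> ymax" unfolding ymax_def
    using p root_symbol_le[of \<theta>] g_pos[of 0] g_le_iff[of 0 x] by (intro frac_le) auto
  then show "z \<in> {0..ymax\<^sup>2}" using p root_symbol_nonneg[of \<theta>] g_pos[of x] by (auto intro!: power_mono)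
next
  fix z assume z: "z \<in> {0..ymax\<^sup>2}"
  have g0: "0 < g 0" using g_pos[of 0] by simp
  have "sqrt z \<le> ymax" using z ymax_pos by (intro real_le_lsqrt) auto
  then have "g 0 * sqrt z \<le> sqrt 12" using g0 by (simp add: ymax_def field_simps)
  then obtain \<theta> where \<theta>: "0 \<le> \<theta>" "\<theta> \<le> pi" "root_symbol \<theta> = g 0 * sqrt z"
    using IVT'[of root_symbol 0 "g 0 * sqrt z" pi] continuous_on_root_symbol g0 z by auto
  then have "omega1 \<phi> (0, \<theta>) = z" using g0 z by (simp add: omega1_eq)
  then show "z \<in> omega1 \<phi> ` symbol_dom"
    using \<theta> by (intro image_eqI[of _ _ "(0, \<theta>)"]) (auto simp: symbol_dom_def)
qed

text \<open>The rearrangement is an inverse of the distribution function: both the range of \<^term>\<open>omega1 \<phi>\<close>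
  and the measure of its sublevel sets are known, so the defining infimum is a quantile of
  \<open>\<lambda>z. Psi_sqrt \<phi> (sqrt z)\<close>.\<close>

lemma sqrt_xi1_quantile:
  assumes x: "0 < x" "x < 1"
  shows "0 < sqrt (xi1 \<phi> x)" "sqrt (xi1 \<phi> x) < ymax" "Psi_sqrt \<phi> (sqrt (xi1 \<phi> x)) = pi * x"
proof -
  define r where "r = Inf {z \<in> {0..ymax\<^sup>2}. pi * x < Psi_sqrt \<phi> (sqrt z)}"
  have "measure lebesgue {p \<in> symbol_dom. omega1 \<phi> p \<le> z} = Psi_sqrt \<phi> (sqrt z)" for z
    by (simp add: Psi_sqrt_def)
  then have xi: "xi1 \<phi> x = r"
    using x by (simp add: xi1_def xi1_open_def range_omega1 r_def)
  have ym: "sqrt (ymax\<^sup>2) = ymax" using ymax_pos by simp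
  have cont: "continuous_on {0..ymax\<^sup>2} (\<lambda>z. Psi_sqrt \<phi> (sqrt z))"
    by (intro continuous_on_compose2[OF continuous_on_Psi_sqrt] continuous_intros) auto
  have ends: "Psi_sqrt \<phi> (sqrt 0) < pi * x" "pi * x < Psi_sqrt \<phi> (sqrt (ymax\<^sup>2))"
    unfolding ym Psi_sqrt_ymax using x by (simp_all add: Psi_sqrt_0)
  have "0 < r" "r < ymax\<^sup>2" "Psi_sqrt \<phi> (sqrt r) = pi * x"
    unfolding r_def
    by (rule quantile_attained[of "ymax\<^sup>2" "\<lambda>z. Psi_sqrt \<phi> (sqrt z)", OF cont _ ends]; simp)+
  then show "0 < sqrt (xi1 \<phi> x)" "sqrt (xi1 \<phi> x) < ymax" "Psi_sqrt \<phi> (sqrt (xi1 \<phi> x)) = pi * x"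
    using ymax_pos by (auto simp: xi intro: real_less_lsqrt)
qed

text \<open>Substituting \<open>y = sqrt (xi1 \<phi> x)\<close>, which tends to \<open>0\<close> from the right, into
  \<open>Psi_sqrt \<phi> y \<sim> y\<close> turns the left-hand side into \<open>\<pi> x\<close>.\<close>

lemma sqrt_xi1_asymp: "(\<lambda>x. sqrt (xi1 \<phi> x)) \<sim>[at_right 0] (\<lambda>x. pi * x)"
proof -
  let ?r = "\<lambda>x. sqrt (xi1 \<phi> x)"
  have ev01: "eventually (\<lambda>x. 0 < x \<and> x < 1) (at_right (0::real))"
    by (auto simp: eventually_at_right_field intro: exI[of _ 1])
  have pos: "eventually (\<lambda>x. 0 < ?r x) (at_right 0)"
    using ev01 by eventually_elim (use sqrt_xi1_quantile(1) in blast)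
  have "(?r \<longlongrightarrow> 0) (at_right 0)"
  proof (rule order_tendstoI)
    show "eventually (\<lambda>x. a < ?r x) (at_right 0)" if "a < 0" for a
      using pos by eventually_elim (use that in linarith)
    show "eventually (\<lambda>x. ?r x < \<eta>) (at_right 0)" if \<eta>: "0 < \<eta>" for \<eta>
    proof -
      have "eventually (\<lambda>x. x < Psi_sqrt \<phi> \<eta> / pi) (at_right 0)"
        using Psi_sqrt_pos[OF \<eta>] by (auto simp: eventually_at_right_field intro!: exI[of _ "Psi_sqrt \<phi> \<eta> / pi"])
      then show ?thesis using ev01
      proof eventually_elim
        case (elim x)
        then have "Psi_sqrt \<phi> (?r x) < Psi_sqrt \<phi> \<eta>" by (simp add: sqrt_xi1_quantile field_simps)
        then show ?case using Psi_sqrt_mono[of \<eta> "?r x"] by (cases "?r x < \<eta>") auto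
      qed
    qed
  qed
  then have "filterlim ?r (at_right 0) (at_right 0)"
    using pos by (auto simp: filterlim_at elim: eventually_mono)
  from filterlim_compose[OF Psi_sqrt_asymp this]
  have "((\<lambda>x. Psi_sqrt \<phi> (?r x) / ?r x) \<longlongrightarrow> 1) (at_right 0)" .
  moreover have "eventually (\<lambda>x. Psi_sqrt \<phi> (?r x) / ?r x = pi * x / ?r x) (at_right 0)"
    using ev01 by eventually_elim (simp add: sqrt_xi1_quantile)
  ultimately have "((\<lambda>x. pi * x / ?r x) \<longlongrightarrow> 1) (at_right 0)"
    by (rule Lim_transform_eventually)
  then show ?thesis by (intro asymp_equiv_symI[OF asymp_equivI'])
qed

text \<open>Between consecutive nodes \<^term>\<open>Psi_sqrt \<phi>\<close> grows by \<open>\<pi> / n\<close>, and by the mean value theorem this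
  growth is at most the supremum \<open>S\<close> of its derivative times the gap. The same equation shows that
  the derivative is positive at the intermediate point, hence \<open>S > 0\<close>, which excludes the
  degenerate values of \<open>1 / S\<close> in the extended reals; \<open>S = \<infinity>\<close> gives the trivial bound \<open>0\<close>.\<close>

lemma approx_gap_ge:
  assumes n: "1 \<le> n"
  shows "1 / (SUP y\<in>{0<..<ymax}. ereal (deriv (Psi_sqrt \<phi>) y)) * ereal pi \<le> approx_gap \<phi> n"
proof -
  let ?S = "SUP y\<in>{0<..<ymax}. ereal (deriv (Psi_sqrt \<phi>) y)"
  let ?r = "\<lambda>i. sqrt (xi1 \<phi> (real i / real n))"
  have gap: "1 / ?S * ereal (pi / real n) \<le> ereal (?r (i + 1) - ?r i)" if i: "i \<in> {1..n - 2}" for i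
  proof -
    have x: "0 < real i / real n" "real i / real n < real (i + 1) / real n" "real (i + 1) / real n < 1"
      using i n by (auto simp: divide_simps)
    have x': "real i / real n < 1" "0 < real (i + 1) / real n" using x by linarith+
    note r0 = sqrt_xi1_quantile[OF x(1) x'(1)] and r1 = sqrt_xi1_quantile[OF x'(2) x(3)]
    have "Psi_sqrt \<phi> (?r i) < Psi_sqrt \<phi> (?r (i + 1))" unfolding r0(3) r1(3)
      using x(2) by (intro mult_strict_left_mono) auto
    then have lt: "?r i < ?r (i + 1)" using Psi_sqrt_mono[of "?r (i + 1)" "?r i"] by linarith
    have "(Psi_sqrt \<phi> has_real_derivative deriv (Psi_sqrt \<phi>) y) (at y)" if "0 < y" for y
      using Psi_sqrt_deriv[OF that] DERIV_imp_deriv by blast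
    then obtain c where c: "?r i < c" "c < ?r (i + 1)"
      "Psi_sqrt \<phi> (?r (i + 1)) - Psi_sqrt \<phi> (?r i) = (?r (i + 1) - ?r i) * deriv (Psi_sqrt \<phi>) c"
      using MVT2[OF lt, of "Psi_sqrt \<phi>" "deriv (Psi_sqrt \<phi>)"] r0(1) by auto
    let ?d = "?r (i + 1) - ?r i" and ?D = "deriv (Psi_sqrt \<phi>) c"
    have "pi / real n = pi * (real (i + 1) / real n) - pi * (real i / real n)"
      using n by (simp add: field_simps)
    then have eq: "pi / real n = ?d * ?D" using c(3) r0(3) r1(3) by simp
    have "0 < ?d * ?D" unfolding eq[symmetric] using n by simp
    then have D: "0 < ?D" using lt by (simp add: zero_less_mult_iff)
    have "c \<in> {0<..<ymax}" unfolding greaterThanLessThan_iff using c r0(1) r1(2) by linarith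
    then have DS: "ereal ?D \<le> ?S" by (rule SUP_upper)
    show ?thesis
    proof (cases ?S)
      case (real \<sigma>)
      then have \<sigma>: "?D \<le> \<sigma>" using DS by simp
      have "pi / real n / \<sigma> \<le> ?d"
        unfolding eq using \<sigma> D lt by (simp add: divide_le_eq mult_left_mono)
      then show ?thesis using \<sigma> D unfolding real by (simp add: one_ereal_def mult.commute)
    next
      case PInf
      then show ?thesis using lt by simp
    next
      case MInf
      then show ?thesis using DS by simp
    qed
  qed
  have "1 / ?S * ereal pi = ereal (real n) * (1 / ?S * ereal (pi / real n))"
  proof -
    have "ereal pi = ereal (real n) * ereal (pi / real n)" using n by simp
    then show ?thesis by (simp only: mult_ac)
  qed
  also have "\<dots> \<le> approx_gap \<phi> n"
    unfolding approx_gap_def using gap by (intro ereal_mult_left_mono INF_greatest) auto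
  finally show ?thesis .
qed

end

theorem corollary4p1:
  fixes \<phi> :: "real \<Rightarrow> real"
  assumes "\<phi> \<in> C01" and "strictly_convex_on {0..1} \<phi>"
  shows "Psi_sqrt \<phi> differentiable_on {0<..<sqrt 12 / D01 \<phi> 0} \<and>
         (\<forall>n::nat. n \<ge> 1 \<longrightarrow>
            approx_gap \<phi> n \<ge>
              1 / (SUP y\<in>{0<..<sqrt 12 / D01 \<phi> 0}. ereal (deriv (Psi_sqrt \<phi>) y)) * ereal pi) \<and>
         (\<lambda>x. sqrt (xi1 \<phi> x)) \<sim>[at_right 0] (\<lambda>x. pi * x)"
proof -
  interpret convex_unit_map \<phi> using assms by unfold_locales
  have "Psi_sqrt \<phi> differentiable (at y)" if "0 < y" for y
    using Psi_sqrt_deriv[OF that] by (auto intro: differentiableI simp: has_field_derivative_def)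
  then have "Psi_sqrt \<phi> differentiable_on {0<..<sqrt 12 / D01 \<phi> 0}"
    by (auto simp: differentiable_on_def intro: differentiable_at_withinI)
  then show ?thesis using approx_gap_ge sqrt_xi1_asymp by (auto simp: ymax_def)
qed

end
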